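(* Let $G=(V,E)$ be a finite simple graph, let $w\colon E\to\mathbb{R}_+$ be a weight function, and let $\mathcal{K}$ denote the family of vertex sets of complete subgraphs of $G$. Then $$\|d_w\|_+\le\min\Bigl\{\sum_{K\in\mathcal{K}}\bigl\lceil\tfrac{|K|}{2}\bigr\rceil\cdot\bigl\lfloor\tfrac{|K|}{2}\bigr\rfloor\cdot z(K)\ \Big|\ z\colon\mathcal{K}\to\mathbb{R}_+,\ \sum_{K\in\mathcal{K},\,e\in E[K]}z(K)=w(e)\text{ for each }e\in E\Bigr\}.$$
   Context: $\mathbb{R}_+$ denotes the nonnegative reals; $E[K]$ is the set of edges of $G$ with both endpoints in $K$. The weighted cut function $d_w\colon 2^V\to\mathbb{R}$ assigns to $X\subseteq V$ the total $w$-weight of the edges with exactly one endpoint in $X$. A set function $\varphi\colon 2^V\to\mathbb{R}$ is increasing (decreasing) if $X\subseteq Y$ implies $\varphi(X)\le\varphi(Y)$ (respectively $\varphi(X)\ge\varphi(Y)$), and submodular if $\varphi(X)+\varphi(Y)\ge\varphi(X\cap Y)+\varphi(X\cup Y)$ for all $X,Y\subseteq V$. A monotonic sum-decomposition of $\varphi$ (with $\varphi(\emptyset)=0$) is $\varphi=\varphi_1+\varphi_2$ with $\varphi_1$ increasing submodular, $\varphi_2$ decreasing submodular, $\varphi_1(\emptyset)=\varphi_2(\emptyset)=0$. Define $\|\varphi\|_+=\min\{\varphi_1(V)\mid\varphi=\varphi_1+\varphi_2\text{ is a monotonic sum-decomposition}\}$. *)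

theory Defs
  imports "HOL-Analysis.Analysis" "HOL-Library.Ramsey"
begin

definition simple_graph :: "'a set \<Rightarrow> 'a set set \<Rightarrow> bool" where
  "simple_graph V E \<longleftrightarrow> finite V \<and> E \<subseteq> [V]\<^bsup>2\<^esup>"

text \<open>The empty set and the singletons are included.\<close>
definition cliques :: "'a set \<Rightarrow> 'a set set \<Rightarrow> 'a set set" where
  "cliques V E = {K. K \<subseteq> V \<and> clique K E}"

definition induced_edges :: "'a set set \<Rightarrow> 'a set \<Rightarrow> 'a set set" where
  "induced_edges E K = {e \<in> E. e \<subseteq> K}"

definition weighted_cut :: "'a set set \<Rightarrow> ('a set \<Rightarrow> real) \<Rightarrow> 'a set \<Rightarrow> real" where
  "weighted_cut E w X = (\<Sum>e | e \<in> E \<and> card (e \<inter> X) = 1. w e)"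

text \<open>A set function on the subsets of \<open>V\<close> is a function on \<^typ>\<open>'a set\<close> of which only the
  values on \<^term>\<open>Pow V\<close> matter.\<close>

definition submodular_on :: "'a set \<Rightarrow> ('a set \<Rightarrow> real) \<Rightarrow> bool" where
  "submodular_on V \<phi> \<longleftrightarrow>
     (\<forall>X\<in>Pow V. \<forall>Y\<in>Pow V. \<phi> X + \<phi> Y \<ge> \<phi> (X \<inter> Y) + \<phi> (X \<union> Y))"

definition monotonic_sum_decomposition ::
    "'a set \<Rightarrow> ('a set \<Rightarrow> real) \<Rightarrow> ('a set \<Rightarrow> real) \<Rightarrow> ('a set \<Rightarrow> real) \<Rightarrow> bool" where
  "monotonic_sum_decomposition V \<phi> \<phi>1 \<phi>2 \<longleftrightarrow>
     (\<forall>X\<in>Pow V. \<phi> X = \<phi>1 X + \<phi>2 X) \<and>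
     mono_on (Pow V) \<phi>1 \<and> submodular_on V \<phi>1 \<and>
     antimono_on (Pow V) \<phi>2 \<and> submodular_on V \<phi>2 \<and>
     \<phi>1 {} = 0 \<and> \<phi>2 {} = 0"

definition plus_norm_values :: "'a set \<Rightarrow> ('a set \<Rightarrow> real) \<Rightarrow> real set" where
  "plus_norm_values V \<phi> = {\<phi>1 V |\<phi>1 \<phi>2. monotonic_sum_decomposition V \<phi> \<phi>1 \<phi>2}"

definition has_minimum :: "real set \<Rightarrow> bool" where
  "has_minimum A \<longleftrightarrow> (\<exists>m\<in>A. \<forall>x\<in>A. m \<le> x)"

text \<open>Meaningful only if \<^const>\<open>has_minimum\<close> holds; \<^const>\<open>Min\<close> is unsuitable because
  it is restricted to finite sets.\<close>
definition minimum :: "real set \<Rightarrow> real" where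
  "minimum A = (LEAST m. m \<in> A)"

definition plus_norm :: "'a set \<Rightarrow> ('a set \<Rightarrow> real) \<Rightarrow> real" where
  "plus_norm V \<phi> = minimum (plus_norm_values V \<phi>)"

definition clique_decomposition ::
    "'a set \<Rightarrow> 'a set set \<Rightarrow> ('a set \<Rightarrow> real) \<Rightarrow> ('a set \<Rightarrow> real) \<Rightarrow> bool" where
  "clique_decomposition V E w z \<longleftrightarrow>
     (\<forall>K\<in>cliques V E. z K \<ge> 0) \<and>
     (\<forall>e\<in>E. (\<Sum>K | K \<in> cliques V E \<and> e \<in> induced_edges E K. z K) = w e)"

definition clique_cost :: "'a set \<Rightarrow> 'a set set \<Rightarrow> ('a set \<Rightarrow> real) \<Rightarrow> real" where
  "clique_cost V E z =
     (\<Sum>K\<in>cliques V E. of_int \<lceil>real (card K) / 2\<rceil> * of_int \<lfloor>real (card K) / 2\<rfloor> * z K)"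

end

theory Submission
  imports Defs
begin

text \<open>
  For a single clique \<open>K\<close> on \<open>n\<close> vertices the cut function is \<open>|X \<inter> K| (n - |X \<inter> K|)\<close>, a concave
  function of \<open>k = |X \<inter> K|\<close>: it is the partial sum over \<open>j < k\<close> of the decreasing increments
  \<open>n - 2 j - 1\<close>. Splitting each increment into its positive and its negative part keeps the
  increments decreasing, hence writes the cut function as an increasing plus a decreasing function,
  both concave in \<open>|X \<inter> K|\<close> and so submodular. The increasing part stops growing at
  \<open>k = \<lfloor>n / 2\<rfloor>\<close>, so its value on \<open>V\<close> is the maximum cut \<open>\<lceil>n / 2\<rceil> \<lfloor>n / 2\<rfloor>\<close>.

  A feasible \<open>z\<close> expresses \<open>d\<^sub>w\<close> as the combination of the clique cuts with the nonnegative
  coefficients \<open>z K\<close> (\<open>weighted_cut_eq_sum_cliques\<close>). The same combination of the two parts is a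
  monotonic sum-decomposition whose value on \<open>V\<close> is the cost of \<open>z\<close>. So every clique cost is
  among the values over which \<open>\<parallel>d\<^sub>w\<parallel>\<^sub>+\<close> minimises (\<open>clique_cost_in_plus_norm_values\<close>).

  Both minima are attained for the same reason (\<open>attains_minimum\<close>): after a harmless
  normalisation, every coordinate of a feasible point lies between \<open>0\<close> and the objective, so the
  sublevel sets are compact. The edges themselves, with their weights, give a feasible \<open>z\<close>, so neither
  problem is infeasible.
\<close>

section \<open>Minima of functionals that bound all coordinates\<close>

lemma minimum_in:
  assumes "has_minimum A"
  shows "minimum A \<in> A"
proof -
  obtain m where m: "m \<in> A" "\<forall>x\<in>A. m \<le> x"
    using assms by (auto simp: has_minimum_def)
  then have "(LEAST m. m \<in> A) = m"
    by (intro Least_equality) auto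
  then show ?thesis using m by (simp add: minimum_def)
qed

lemma minimum_le:
  assumes "has_minimum A" "x \<in> A"
  shows "minimum A \<le> x"
proof -
  obtain m where m: "m \<in> A" "\<forall>x\<in>A. m \<le> x"
    using assms(1) by (auto simp: has_minimum_def)
  then have "(LEAST m. m \<in> A) = m"
    by (intro Least_equality) auto
  then show ?thesis using m assms(2) by (simp add: minimum_def)
qed

text \<open>The sublevel set of \<open>c\<close> at a point of \<open>A\<close> is a closed subset of a cube, which is compact
  by Tychonoff's theorem whatever the index type.\<close>

lemma attains_minimum:
  fixes A :: "('i \<Rightarrow> real) set" and c :: "('i \<Rightarrow> real) \<Rightarrow> real"
  assumes "closed A" "A \<noteq> {}" and c: "continuous_on UNIV c"
    and bounds: "\<And>f i. f \<in> A \<Longrightarrow> 0 \<le> f i \<and> f i \<le> c f"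
  shows "\<exists>f\<in>A. \<forall>g\<in>A. c f \<le> c g"
proof -
  obtain f0 where f0: "f0 \<in> A" using assms(2) by blast
  let ?B = "PiE UNIV (\<lambda>_::'i. {0..c f0})"
  let ?S = "A \<inter> {f. c f \<le> c f0}"
  have "compactin (product_topology (\<lambda>_::'i. euclidean) UNIV) ?B"
    by (subst compactin_PiE) auto
  then have "compact ?B"
    by (simp add: euclidean_product_topology)
  moreover have "closed ?S"
    by (intro closed_Int assms(1) closed_Collect_le c continuous_on_const)
  moreover have "?S \<subseteq> ?B"
    using bounds by (fastforce intro: order_trans)
  ultimately have "compact ?S"
    by (metis compact_Int_closed inf.absorb_iff2)
  moreover have "?S \<noteq> {}" using f0 by blast
  moreover have "continuous_on ?S c"
    using c by (rule continuous_on_subset) simp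
  ultimately obtain f where f: "f \<in> ?S" "\<forall>g\<in>?S. c f \<le> c g"
    by (rule continuous_attains_inf[THEN bexE])
  show ?thesis
  proof (intro bexI ballI)
    show "f \<in> A" using f(1) by simp
    fix g assume "g \<in> A"
    then show "c f \<le> c g"
      using f by (cases "c g \<le> c f0") auto
  qed
qed

text \<open>A decomposition is determined by its increasing part on \<open>Pow V\<close>, whose values lie between
  \<open>0\<close> and the value on \<open>V\<close>; outside \<open>Pow V\<close> the increasing part is normalised to \<open>0\<close>.\<close>

lemma has_minimum_plus_norm_values:
  assumes "plus_norm_values V \<phi> \<noteq> {}"
  shows "has_minimum (plus_norm_values V \<phi>)"
proof -
  let ?A = "{f. (\<forall>X. X \<notin> Pow V \<longrightarrow> f X = 0) \<and> monotonic_sum_decomposition V \<phi> f (\<lambda>X. \<phi> X - f X)}"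
  have normalise: "\<exists>f\<in>?A. f V = x" if "x \<in> plus_norm_values V \<phi>" for x
  proof -
    obtain f1 f2 where f: "monotonic_sum_decomposition V \<phi> f1 f2" "x = f1 V"
      using \<open>x \<in> plus_norm_values V \<phi>\<close> by (auto simp: plus_norm_values_def)
    let ?f = "\<lambda>X. if X \<subseteq> V then f1 X else 0"
    have "monotonic_sum_decomposition V \<phi> ?f (\<lambda>X. \<phi> X - ?f X)"
      using f(1) unfolding monotonic_sum_decomposition_def submodular_on_def monotone_on_def
      by (auto simp: Ball_def le_infI1)
    then show ?thesis using f(2) by (intro bexI[of _ ?f]) auto
  qed
  have "closed ?A"
    unfolding monotonic_sum_decomposition_def submodular_on_def monotone_on_def Ball_def
    by (intro closed_Collect_conj closed_Collect_all closed_Collect_imp open_Collect_const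
        closed_Collect_le closed_Collect_eq continuous_intros continuous_on_product_coordinates)
  moreover have "?A \<noteq> {}"
  proof -
    obtain x where "x \<in> plus_norm_values V \<phi>" using assms by blast
    from normalise[OF this] show ?thesis by (rule bexE) (rule ex_in_conv[THEN iffD1], rule exI)
  qed
  moreover have "continuous_on UNIV (\<lambda>f::'a set \<Rightarrow> real. f V)"
    by (rule continuous_on_product_coordinates)
  moreover have "0 \<le> f X \<and> f X \<le> f V" if "f \<in> ?A" for f X
  proof -
    have f: "f X = 0" if "\<not> X \<subseteq> V" for X
      using \<open>f \<in> ?A\<close> that by simp
    have mono: "f X \<le> f Y" if "X \<subseteq> Y" "Y \<subseteq> V" for X Y
      using \<open>f \<in> ?A\<close> that by (auto simp: monotonic_sum_decomposition_def monotone_on_def)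
    have "f {} = 0"
      using \<open>f \<in> ?A\<close> by (simp add: monotonic_sum_decomposition_def)
    then show ?thesis
      using f[of X] mono[of "{}" X] mono[of X V] mono[of "{}" V] by (cases "X \<subseteq> V") auto
  qed
  ultimately have "\<exists>f\<in>?A. \<forall>g\<in>?A. f V \<le> g V"
    by (rule attains_minimum)
  then obtain f where f: "f \<in> ?A" "\<forall>g\<in>?A. f V \<le> g V"
    by (rule bexE)
  have "f V \<in> plus_norm_values V \<phi>"
    using f(1) by (auto simp: plus_norm_values_def)
  moreover have "f V \<le> x" if "x \<in> plus_norm_values V \<phi>" for x
    using normalise[OF that] f(2) by (elim bexE) (drule (1) bspec, simp)
  ultimately show ?thesis
    unfolding has_minimum_def by blast
qed

section \<open>Concave functions of the cardinality\<close>

lemma sum_lessThan_add: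
  fixes g :: "nat \<Rightarrow> real"
  shows "(\<Sum>j<a + i. g j) = (\<Sum>j<a. g j) + (\<Sum>j<i. g (a + j))"
  by (induction i) auto

text \<open>Between \<open>X \<inter> Y\<close> and \<open>X\<close>, and between \<open>Y\<close> and \<open>X \<union> Y\<close>, the same number of increments of
  \<open>g\<close> is collected; the second block starts later, where the increments are smaller.\<close>

lemma submodular_on_concave_card:
  fixes g :: "nat \<Rightarrow> real"
  assumes "antimono g" "finite K"
  shows "submodular_on V (\<lambda>X. \<Sum>j<card (X \<inter> K). g j)"
  unfolding submodular_on_def
proof (intro ballI)
  fix X Y
  let ?G = "\<lambda>k. \<Sum>j<k. g j"
  define a i l where "a = card (X \<inter> Y \<inter> K)" and "i = card ((X - Y) \<inter> K)"
    and "l = card ((Y - X) \<inter> K)"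
  have "card (X \<inter> K) = a + i"
    unfolding a_def i_def using \<open>finite K\<close>
    by (subst card_Un_disjoint[symmetric]) (auto intro!: arg_cong[of _ _ card])
  moreover have "card (Y \<inter> K) = a + l"
    unfolding a_def l_def using \<open>finite K\<close>
    by (subst card_Un_disjoint[symmetric]) (auto intro!: arg_cong[of _ _ card])
  moreover have "card ((X \<union> Y) \<inter> K) = a + l + i"
    unfolding a_def i_def l_def using \<open>finite K\<close>
    by (subst card_Un_disjoint[symmetric], simp, simp, blast)+ (auto intro!: arg_cong[of _ _ card])
  moreover have "(\<Sum>j<i. g (a + l + j)) \<le> (\<Sum>j<i. g (a + j))"
    using \<open>antimono g\<close> by (intro sum_mono) (simp add: antimono_def)
  ultimately show "?G (card (X \<inter> Y \<inter> K)) + ?G (card ((X \<union> Y) \<inter> K))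
      \<le> ?G (card (X \<inter> K)) + ?G (card (Y \<inter> K))"
    by (simp add: sum_lessThan_add a_def[symmetric])
qed

lemma mono_on_sum_card:
  fixes g :: "nat \<Rightarrow> real"
  assumes "\<And>j. 0 \<le> g j" "finite K"
  shows "mono_on S (\<lambda>X::'a set. \<Sum>j<card (X \<inter> K). g j)"
proof (rule monotone_onI)
  fix X Y :: "'a set" assume "X \<subseteq> Y"
  then have "card (X \<inter> K) \<le> card (Y \<inter> K)"
    using assms(2) by (intro card_mono) auto
  then show "(\<Sum>j<card (X \<inter> K). g j) \<le> (\<Sum>j<card (Y \<inter> K). g j)"
    using assms(1) by (intro sum_mono2) auto
qed

lemma antimono_on_sum_card:
  fixes g :: "nat \<Rightarrow> real"
  assumes "\<And>j. g j \<le> 0" "finite K"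
  shows "antimono_on S (\<lambda>X::'a set. \<Sum>j<card (X \<inter> K). g j)"
proof (rule monotone_onI)
  fix X Y :: "'a set" assume "X \<subseteq> Y"
  then have "card (X \<inter> K) \<le> card (Y \<inter> K)"
    using assms(2) by (intro card_mono) auto
  then have "(\<Sum>j<card (X \<inter> K). - g j) \<le> (\<Sum>j<card (Y \<inter> K). - g j)"
    using assms(1) by (intro sum_mono2) auto
  then show "(\<Sum>j<card (Y \<inter> K). g j) \<le> (\<Sum>j<card (X \<inter> K). g j)"
    by (simp add: sum_negf)
qed

section \<open>The cut function of a clique\<close>

text \<open>The increment from \<open>j\<close> to \<open>j + 1\<close> of the cut size \<open>k (n - k)\<close> in a clique on \<open>n\<close> vertices,
  taken in the reals since it becomes negative for \<open>j\<close> beyond \<open>n / 2\<close>.\<close>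

definition cut_increment :: "nat \<Rightarrow> nat \<Rightarrow> real" where
  "cut_increment n j = real n - 2 * real j - 1"

lemma sum_cut_increment: "(\<Sum>j<k. cut_increment n j) = real k * (real n - real k)"
  by (induction k) (auto simp: cut_increment_def algebra_simps)

lemma half_product_eq:
  "of_int \<lceil>real n / 2\<rceil> * of_int \<lfloor>real n / 2\<rfloor> = real (n div 2) * (real n - real (n div 2))"
proof -
  have "\<lfloor>real n / 2\<rfloor> = int (n div 2)"
    using floor_divide_of_nat_eq[of n 2] by simp
  moreover have "\<lceil>real n / 2\<rceil> = int n - int (n div 2)"
    by (rule ceiling_unique) linarith+
  ultimately show ?thesis by simp
qed

text \<open>The increments are positive below \<open>n div 2\<close> and not positive from there on.\<close>

lemma sum_pos_part_cut_increment:
  "(\<Sum>j<n. max 0 (cut_increment n j)) = of_int \<lceil>real n / 2\<rceil> * of_int \<lfloor>real n / 2\<rfloor>"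
proof -
  have "(\<Sum>j<n. max 0 (cut_increment n j)) = (\<Sum>j<n div 2. max 0 (cut_increment n j))"
  proof (rule sum.mono_neutral_right)
    show "\<forall>j\<in>{..<n} - {..<n div 2}. max 0 (cut_increment n j) = 0"
    proof
      fix j assume "j \<in> {..<n} - {..<n div 2}"
      then have "n \<le> 2 * j + 1" by simp linarith
      then show "max 0 (cut_increment n j) = 0" by (simp add: cut_increment_def max_def)
    qed
  qed auto
  also have "\<dots> = (\<Sum>j<n div 2. cut_increment n j)"
  proof (rule sum.cong[OF refl])
    fix j assume "j \<in> {..<n div 2}"
    then have "2 * j + 1 \<le> n" by auto
    then show "max 0 (cut_increment n j) = cut_increment n j"
      by (simp add: cut_increment_def max_def)
  qed
  finally show ?thesis
    by (simp add: sum_cut_increment half_product_eq)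
qed

lemma card_cut_clique:
  assumes "clique K E" "E \<subseteq> [V]\<^bsup>2\<^esup>" "finite K"
  shows "card {e \<in> E. e \<subseteq> K \<and> card (e \<inter> X) = 1} = card (X \<inter> K) * card (K - X)"
proof -
  have "bij_betw (\<lambda>(u, v). {u, v}) ((X \<inter> K) \<times> (K - X)) {e \<in> E. e \<subseteq> K \<and> card (e \<inter> X) = 1}"
    unfolding bij_betw_def
  proof
    show "inj_on (\<lambda>(u, v). {u, v}) ((X \<inter> K) \<times> (K - X))"
      by (auto simp: inj_on_def doubleton_eq_iff)
    show "(\<lambda>(u, v). {u, v}) ` ((X \<inter> K) \<times> (K - X)) = {e \<in> E. e \<subseteq> K \<and> card (e \<inter> X) = 1}"
      (is "?L = ?R")
    proof (intro equalityI subsetI)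
      fix e assume "e \<in> ?L"
      then obtain u v where uv: "u \<in> X \<inter> K" "v \<in> K - X" "e = {u, v}" by auto
      then have "e \<inter> X = {u}" by auto
      then show "e \<in> ?R"
        using uv assms(1) by (auto simp: clique_def)
    next
      fix e assume e: "e \<in> ?R"
      then have "card e = 2" using assms(2) by (auto simp: nsets_def)
      moreover obtain u where u: "e \<inter> X = {u}"
        using e by (auto simp: card_1_singleton_iff)
      ultimately obtain v where v: "e = {u, v}" "u \<noteq> v"
        by (metis IntE insertI1 card_2_iff insert_commute insertE singletonD)
      have "u \<in> X"
        using u by blast
      moreover have "v \<notin> X"
      proof
        assume "v \<in> X"
        then have "v \<in> e \<inter> X" using v(1) by simp
        then show False using u v(2) by simp
      qed
      ultimately have "(u, v) \<in> (X \<inter> K) \<times> (K - X)"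
        using e v(1) by simp
      then show "e \<in> ?L"
        unfolding v(1) by (rule rev_image_eqI) simp
    qed
  qed
  from bij_betw_same_card[OF this] show ?thesis
    by (simp add: card_cartesian_product)
qed

section \<open>From clique decompositions to monotonic sum-decompositions\<close>

lemma finite_cliques: "finite V \<Longrightarrow> finite (cliques V E)"
  by (rule finite_subset[of _ "Pow V"]) (auto simp: cliques_def)

lemma simple_graph_finite_edges:
  assumes "simple_graph V E"
  shows "finite E"
proof (rule finite_subset)
  show "E \<subseteq> Pow V" "finite (Pow V)"
    using assms by (auto simp: simple_graph_def nsets_def)
qed

text \<open>Replace each \<open>w e\<close> by the sum of the \<open>z K\<close> with \<open>e \<in> E[K]\<close> and exchange the two sums.\<close>

lemma weighted_cut_eq_sum_cliques:
  assumes G: "simple_graph V E" and z: "clique_decomposition V E w z"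
  shows "weighted_cut E w X
    = (\<Sum>K\<in>cliques V E. z K * (\<Sum>j<card (X \<inter> K). cut_increment (card K) j))"
proof -
  have fin: "finite V" "finite E" "finite (cliques V E)" and E: "E \<subseteq> [V]\<^bsup>2\<^esup>"
    using G simple_graph_finite_edges[OF G] finite_cliques by (auto simp: simple_graph_def)
  let ?C = "{e \<in> E. card (e \<inter> X) = 1}"
  have "weighted_cut E w X = (\<Sum>e\<in>?C. w e)"
    by (simp add: weighted_cut_def)
  also have "\<dots> = (\<Sum>e\<in>?C. \<Sum>K | K \<in> cliques V E \<and> e \<in> induced_edges E K. z K)"
    using z by (auto simp: clique_decomposition_def intro!: sum.cong)
  also have "\<dots> = (\<Sum>K\<in>cliques V E. \<Sum>e | e \<in> ?C \<and> e \<in> induced_edges E K. z K)"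
    using fin by (intro sum.swap_restrict) auto
  also have "\<dots> = (\<Sum>K\<in>cliques V E. z K * (\<Sum>j<card (X \<inter> K). cut_increment (card K) j))"
  proof (rule sum.cong[OF refl])
    fix K assume "K \<in> cliques V E"
    then have K: "clique K E" "finite K"
      using fin(1) by (auto simp: cliques_def intro: finite_subset)
    have "{e. e \<in> ?C \<and> e \<in> induced_edges E K} = {e \<in> E. e \<subseteq> K \<and> card (e \<inter> X) = 1}"
      by (auto simp: induced_edges_def)
    then have "(\<Sum>e | e \<in> ?C \<and> e \<in> induced_edges E K. z K)
        = z K * real (card (X \<inter> K) * card (K - X))"
      using card_cut_clique[OF K(1) E K(2)] by simp
    moreover have "real (card (K - X)) = real (card K) - real (card (X \<inter> K))"
      using K(2) card_mono[of K "X \<inter> K"] by (simp add: card_Diff_subset_Int Int_commute of_nat_diff)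
    ultimately show "(\<Sum>e | e \<in> ?C \<and> e \<in> induced_edges E K. z K)
        = z K * (\<Sum>j<card (X \<inter> K). cut_increment (card K) j)"
      by (simp add: sum_cut_increment)
  qed
  finally show ?thesis .
qed

lemma submodular_on_nonneg_combination:
  assumes "\<And>K. K \<in> S \<Longrightarrow> 0 \<le> z K" "\<And>K. K \<in> S \<Longrightarrow> submodular_on V (f K)"
  shows "submodular_on V (\<lambda>X. \<Sum>K\<in>S. z K * f K X)"
  unfolding submodular_on_def
proof (intro ballI)
  fix X Y assume "X \<in> Pow V" "Y \<in> Pow V"
  then have "(\<Sum>K\<in>S. z K * (f K (X \<inter> Y) + f K (X \<union> Y))) \<le> (\<Sum>K\<in>S. z K * (f K X + f K Y))"
    using assms by (intro sum_mono mult_left_mono) (auto simp: submodular_on_def)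
  then show "(\<Sum>K\<in>S. z K * f K (X \<inter> Y)) + (\<Sum>K\<in>S. z K * f K (X \<union> Y))
      \<le> (\<Sum>K\<in>S. z K * f K X) + (\<Sum>K\<in>S. z K * f K Y)"
    by (simp add: distrib_left sum.distrib)
qed

lemma clique_cost_in_plus_norm_values:
  assumes G: "simple_graph V E" and z: "clique_decomposition V E w z"
  shows "clique_cost V E z \<in> plus_norm_values V (weighted_cut E w)"
proof -
  define P where "P K X = (\<Sum>j<card (X \<inter> K). max 0 (cut_increment (card K) j))" for K X :: "'a set"
  define N where "N K X = (\<Sum>j<card (X \<inter> K). min 0 (cut_increment (card K) j))" for K X :: "'a set"
  let ?p = "\<lambda>X. \<Sum>K\<in>cliques V E. z K * P K X"
  let ?n = "\<lambda>X. \<Sum>K\<in>cliques V E. z K * N K X"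
  have fin: "finite K" if "K \<in> cliques V E" for K
    using G that by (auto simp: cliques_def simple_graph_def intro: finite_subset)
  have z0: "0 \<le> z K" if "K \<in> cliques V E" for K
    using z that by (simp add: clique_decomposition_def)
  have anti: "antimono (\<lambda>j. max 0 (cut_increment m j))" "antimono (\<lambda>j. min 0 (cut_increment m j))"
    for m
    by (auto simp: antimono_def cut_increment_def)
  have "monotonic_sum_decomposition V (weighted_cut E w) ?p ?n"
    unfolding monotonic_sum_decomposition_def
  proof (intro conjI ballI)
    fix X
    have "P K X + N K X = (\<Sum>j<card (X \<inter> K). cut_increment (card K) j)" for K
      unfolding P_def N_def sum.distrib[symmetric] by (intro sum.cong) auto
    then show "weighted_cut E w X = ?p X + ?n X"
      by (simp add: weighted_cut_eq_sum_cliques[OF G z] sum.distrib[symmetric] distrib_left[symmetric])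
  next
    have "mono_on (Pow V) (P K)" if "K \<in> cliques V E" for K
      unfolding P_def using fin[OF that] by (intro mono_on_sum_card) auto
    then show "mono_on (Pow V) ?p"
      using z0 by (intro monotone_onI sum_mono mult_left_mono) (auto simp: monotone_on_def)
    have "antimono_on (Pow V) (N K)" if "K \<in> cliques V E" for K
      unfolding N_def using fin[OF that] by (intro antimono_on_sum_card) auto
    then show "antimono_on (Pow V) ?n"
      using z0 by (intro monotone_onI sum_mono mult_left_mono) (auto simp: monotone_on_def)
    show "submodular_on V ?p"
      unfolding P_def using fin z0 anti
      by (intro submodular_on_nonneg_combination submodular_on_concave_card)
    show "submodular_on V ?n"
      unfolding N_def using fin z0 anti
      by (intro submodular_on_nonneg_combination submodular_on_concave_card)
  qed (simp_all add: P_def N_def)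
  moreover have "clique_cost V E z = ?p V"
    unfolding clique_cost_def
  proof (rule sum.cong[OF refl])
    fix K assume "K \<in> cliques V E"
    then have "V \<inter> K = K" by (auto simp: cliques_def)
    then show "of_int \<lceil>real (card K) / 2\<rceil> * of_int \<lfloor>real (card K) / 2\<rfloor> * z K = z K * P K V"
      by (simp add: P_def sum_pos_part_cut_increment)
  qed
  ultimately show ?thesis
    by (auto simp: plus_norm_values_def)
qed

section \<open>Existence and optimality of clique decompositions\<close>

lemma edge_clique_decomposition:
  assumes G: "simple_graph V E" and w: "\<forall>e\<in>E. w e \<ge> 0"
  shows "clique_decomposition V E w (\<lambda>K. if K \<in> E then w K else 0)"
  unfolding clique_decomposition_def
proof (intro conjI ballI)
  fix e assume e: "e \<in> E"
  have E: "finite e'" "card e' = 2" "e' \<subseteq> V" if "e' \<in> E" for e'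
    using G subsetD[OF _ that] by (auto simp: simple_graph_def nsets_def)
  obtain a b where "e = {a, b}"
    using E(2)[OF e] by (auto simp: card_2_iff)
  then have "clique e E"
    using e by (auto simp: clique_def insert_commute)
  then have "e \<in> cliques V E"
    using E(3)[OF e] by (simp add: cliques_def)
  moreover have "K = e" if "K \<in> E" "e \<subseteq> K" for K
    using card_subset_eq[of K e] E(1,2)[OF \<open>K \<in> E\<close>] E(2)[OF e] that(2) by metis
  ultimately have "(\<Sum>K | K \<in> cliques V E \<and> e \<in> induced_edges E K. if K \<in> E then w K else 0)
      = (\<Sum>K\<in>{e}. if K \<in> E then w K else 0)"
    using G e by (intro sum.mono_neutral_right)
      (auto simp: induced_edges_def simple_graph_def finite_cliques)
  then show "(\<Sum>K | K \<in> cliques V E \<and> e \<in> induced_edges E K. if K \<in> E then w K else 0) = w e"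
    using e by simp
qed (use w in auto)

text \<open>Cliques with fewer than two vertices induce no edge and cost nothing, so \<open>z\<close> is unbounded
  there; it is normalised to \<open>0\<close> on them. Every other clique has cost coefficient at least \<open>1\<close>,
  so \<open>z K\<close> is at most the cost of \<open>z\<close>.\<close>

lemma has_minimum_clique_cost:
  assumes G: "simple_graph V E" and w: "\<forall>e\<in>E. w e \<ge> 0"
  shows "has_minimum {clique_cost V E z |z. clique_decomposition V E w z}"
proof -
  let ?L = "{K \<in> cliques V E. 2 \<le> card K}"
  let ?A = "{z. clique_decomposition V E w z \<and> (\<forall>K. K \<notin> ?L \<longrightarrow> z K = 0)}"
  let ?c = "\<lambda>K::'a set. of_int \<lceil>real (card K) / 2\<rceil> * of_int \<lfloor>real (card K) / 2\<rfloor> :: real"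
  have fin: "finite V" "finite (cliques V E)"
    using G finite_cliques by (auto simp: simple_graph_def)
  have c1: "1 \<le> ?c K" if "2 \<le> card K" for K
  proof -
    have "1 \<le> \<lfloor>real (card K) / 2\<rfloor>" "1 \<le> \<lceil>real (card K) / 2\<rceil>"
      using that by linarith+
    then have "1 * 1 \<le> ?c K"
      by (intro mult_mono) auto
    then show ?thesis by simp
  qed
  have c0: "0 \<le> ?c K" for K
    by (intro mult_nonneg_nonneg) auto
  have normalise: "\<exists>z'\<in>?A. clique_cost V E z' = clique_cost V E z"
    if z: "clique_decomposition V E w z" for z
  proof -
    let ?z = "\<lambda>K. if K \<in> ?L then z K else 0"
    have big: "2 \<le> card K" if "K \<in> cliques V E" "e \<in> induced_edges E K" for e K
    proof -
      have "finite K" using that(1) fin(1) by (auto simp: cliques_def intro: finite_subset)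
      moreover have "card e = 2" "e \<subseteq> K"
        using that(2) G by (auto simp: induced_edges_def simple_graph_def nsets_def)
      ultimately show ?thesis by (metis card_mono)
    qed
    have "(\<Sum>K | K \<in> cliques V E \<and> e \<in> induced_edges E K. ?z K)
        = (\<Sum>K | K \<in> cliques V E \<and> e \<in> induced_edges E K. z K)" for e
      using big by (intro sum.cong) auto
    then have "clique_decomposition V E w ?z"
      using z unfolding clique_decomposition_def by auto
    moreover have "clique_cost V E ?z = clique_cost V E z"
      unfolding clique_cost_def
    proof (rule sum.cong[OF refl])
      fix K assume K: "K \<in> cliques V E"
      show "?c K * ?z K = ?c K * z K"
      proof (cases "2 \<le> card K")
        case False
        then have "card K div 2 = 0" by simp
        then have "?c K = 0" by (simp only: half_product_eq)
        then show ?thesis by simp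
      qed (use K in simp)
    qed
    ultimately show ?thesis by (intro bexI[of _ ?z]) auto
  qed
  have "closed ?A"
    unfolding clique_decomposition_def Ball_def
    by (intro closed_Collect_conj closed_Collect_all closed_Collect_imp open_Collect_const
        closed_Collect_le closed_Collect_eq continuous_intros continuous_on_product_coordinates)
  moreover have "?A \<noteq> {}"
    using normalise[OF edge_clique_decomposition[OF G w]]
    by (rule bexE) (rule ex_in_conv[THEN iffD1], rule exI)
  moreover have "continuous_on UNIV (clique_cost V E)"
    unfolding clique_cost_def
    by (intro continuous_intros continuous_on_product_coordinates)
  moreover have "0 \<le> z K \<and> z K \<le> clique_cost V E z" if "z \<in> ?A" for z K
  proof -
    have z0: "0 \<le> z K'" for K'
      using that by (cases "K' \<in> ?L") (auto simp: clique_decomposition_def)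
    have "z K \<le> clique_cost V E z"
    proof (cases "K \<in> ?L")
      case True
      then have "1 * z K \<le> ?c K * z K"
        using c1 z0 by (intro mult_right_mono) auto
      also have "\<dots> \<le> clique_cost V E z"
        unfolding clique_cost_def using True fin(2) z0 c0
        by (intro member_le_sum) auto
      finally show ?thesis by simp
    next
      case False
      then have "z K = 0" using that by simp
      then show ?thesis
        unfolding clique_cost_def using z0 c0 by (simp add: sum_nonneg)
    qed
    then show ?thesis using z0 by simp
  qed
  ultimately have "\<exists>z\<in>?A. \<forall>y\<in>?A. clique_cost V E z \<le> clique_cost V E y"
    by (rule attains_minimum)
  then obtain z where z: "z \<in> ?A" "\<forall>y\<in>?A. clique_cost V E z \<le> clique_cost V E y"
    by (rule bexE)
  have "clique_cost V E z \<le> clique_cost V E y" if "clique_decomposition V E w y" for y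
    using normalise[OF that] z(2) by (elim bexE) (drule (1) bspec, simp)
  then show ?thesis
    unfolding has_minimum_def using z(1) by blast
qed

section \<open>The bound on the norm of the cut function\<close>

theorem theorem7p7:
  fixes V :: "'a set" and E :: "'a set set" and w :: "'a set \<Rightarrow> real"
  assumes "simple_graph V E"
    and "\<forall>e\<in>E. w e \<ge> 0"
  shows "has_minimum (plus_norm_values V (weighted_cut E w)) \<and>
    has_minimum {clique_cost V E z |z. clique_decomposition V E w z} \<and>
    plus_norm V (weighted_cut E w)
      \<le> minimum {clique_cost V E z |z. clique_decomposition V E w z}"
proof -
  let ?C = "{clique_cost V E z |z. clique_decomposition V E w z}"
  let ?P = "plus_norm_values V (weighted_cut E w)"
  have C: "has_minimum ?C"
    using has_minimum_clique_cost[OF assms] .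
  have sub: "?C \<subseteq> ?P"
    using clique_cost_in_plus_norm_values[OF assms(1)] by blast
  then have "minimum ?C \<in> ?P"
    using minimum_in[OF C] by blast
  moreover from this have P: "has_minimum ?P"
    by (intro has_minimum_plus_norm_values) blast
  ultimately have "plus_norm V (weighted_cut E w) \<le> minimum ?C"
    unfolding plus_norm_def by (intro minimum_le)
  with C P show ?thesis by blast
qed

end
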